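(* Let $\alpha \ge 0$ and $\sigma \in \mathbb{R}$. Let the plant $\dot x_p = A_p x_p + B_p u$, $y = C_p x_p$ be given, with $x_p(t)\in\mathbb{R}^{n_p}$, $u(t)\in\mathbb{R}^{n_u}$, $y(t)\in\mathbb{R}^{n_y}$. Let the neural network controller $$\begin{bmatrix}\dot x_k\\ v_k\\ \tilde u\end{bmatrix}=\begin{bmatrix}A_k & B_{kw} & B_{ky}\\ C_{kv} & D_{kvw} & D_{kvy}\\ C_{ku} & D_{kuw} & D_{kuy}\end{bmatrix}\begin{bmatrix}x_k\\ w_k\\ y\end{bmatrix},\qquad w_k(t)=\phi(v_k(t)),$$ be given, with $x_k(t)\in\mathbb{R}^{n_k}$ and $v_k(t),w_k(t)\in\mathbb{R}^{n_\phi}$. Define $$A=\begin{bmatrix}A_p+B_pD_{kuy}C_p & B_pC_{ku}\\ B_{ky}C_p & A_k\end{bmatrix},\quad B_w=\begin{bmatrix}B_p & B_pD_{kuw}\\ 0 & B_{kw}\end{bmatrix},$$ $$C_v=\begin{bmatrix}D_{kuy}C_p & C_{ku}\\ D_{kvy}C_p & C_{kv}\end{bmatrix},\quad D_{vw}=\begin{bmatrix}\frac{1+\sigma}{2}I & D_{kuw}\\ 0 & D_{kvw}\end{bmatrix}.$$ For $\Lambda_p\in\mathbb{R}^{n_u\times n_u}$ and $\Lambda_k\in\mathbb{R}^{n_\phi\times n_\phi}$ let $$M=\begin{bmatrix}\alpha^2\Lambda_p & 0 & 0 & 0\\ 0&0&0&\Lambda_k\\ 0&0&-\Lambda_p&0\\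 0&\Lambda_k&0&-2\Lambda_k\end{bmatrix}.$$ If there exist a symmetric $X\in\mathbb{R}^{(n_p+n_k)\times(n_p+n_k)}$ with $X\succ0$, a diagonal $\Lambda_p\in\mathbb{R}^{n_u\times n_u}$ with $\Lambda_p\succeq0$, and a diagonal $\Lambda_k\in\mathbb{R}^{n_\phi\times n_\phi}$ with $\Lambda_k\succeq0$ such that $$\begin{bmatrix}A^\top X+XA & XB_w\\ B_w^\top X & 0\end{bmatrix}+\begin{bmatrix}C_v & D_{vw}\\ 0& I\end{bmatrix}^\top M\begin{bmatrix}C_v & D_{vw}\\ 0& I\end{bmatrix}\preceq0,$$ then the controller satisfies the disk margin $D(\alpha,\sigma)$.
   Context: All matrices are real. $\mathcal{L}_{2e}^n$ is the space of functions $\mathbb{R}_{\ge0}\to\mathbb{R}^n$ that are square-integrable on $[0,T]$ for every $T>0$. Activation function: $\phi:\mathbb{R}^{n_\phi}\to\mathbb{R}^{n_\phi}$ is memoryless and applied elementwise, $(\phi(v))_i=\phi_i(v_i)$, where each scalar $\phi_i:\mathbb{R}\to\mathbb{R}$ is sector-bounded in $[0,1]$ (that is, $\phi_i(s)(s-\phi_i(s))\ge0$ for all $s$) and slope-restricted in $[0,1]$ (that is, $0\le\frac{\phi_i(a)-\phi_i(b)}{a-b}\le1$ for all $a\ne b$). Uncertainty: $\Delta_p$ ranges over (possibly nonlinear, time-varying) causal operators $\mathcal{L}_{2e}^{n_u}\to\mathcal{L}_{2e}^{n_u}$ that are diagonal, i.e. $(\Delta_p(v))_i=\Delta_{p,i}(v_i)$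 for each channel $i$, and have $\mathcal{L}_2$ gain less than $\alpha$, i.e. there is $0\le\gamma<\alpha$ with $\int_0^T\|\Delta_p(v)(t)\|^2dt\le\gamma^2\int_0^T\|v(t)\|^2dt$ for all $v\in\mathcal{L}_{2e}^{n_u}$ and $T\ge0$. Uncertain plant: for such a $\Delta_p$, the uncertain plant $\tilde P_{\Delta_p}$ with input $\tilde u$ and output $y$ is given by the plant equations $\dot x_p=A_px_p+B_pu$, $y=C_px_p$ together with $$u=v_p+\tfrac{1-\sigma}{2}w_p,\qquad v_p=\tilde u+\tfrac{1+\sigma}{2}w_p,\qquad w_p=\Delta_p(v_p).$$ Let $\mathcal{M}_\alpha$ be the set of all $\tilde P_{\Delta_p}$ where $\Delta_p$ is a causal, diagonal operator $\mathcal{L}_{2e}^{n_u}\to\mathcal{L}_{2e}^{n_u}$ with $\mathcal{L}_2$ gain less than $\alpha$. Disk margin: the controller satisfies the disk margin $D(\alpha,\sigma)$ if it stabilizes every plant in $\mathcal{M}_\alpha$, i.e. for every $\tilde P_{\Delta_p}\in\mathcal{M}_\alpha$ the closed loop of $\tilde P_{\Delta_p}$ and the controller (obtained by connecting $y$ and $\tilde u$) is stable. Stability is Lyapunov stability of the origin in the closed-loop state $x=(x_p,x_k)$: for every $\varepsilon>0$ there is $\delta>0$ such that every closed-loop trajectory with $\|x(0)\|<\delta$ satisfies $\|x(t)\|<\varepsilon$ for all $t\ge0$. Here a closed-loop trajectory consists of an absolutely continuous $x=(x_p,x_k)$ and $v_p,v_k,w_p,w_k\in\mathcal{L}_{2e}$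 satisfying, for almost every $t\ge0$, the plant equations $\dot x_p=A_px_p+B_pu$, $y=C_px_p$; the uncertainty equations $u=v_p+\tfrac{1-\sigma}{2}w_p$, $v_p=\tilde u+\tfrac{1+\sigma}{2}w_p$, $w_p=\Delta_p(v_p)$; and the controller equations $\dot x_k=A_kx_k+B_{kw}w_k+B_{ky}y$, $v_k=C_{kv}x_k+D_{kvw}w_k+D_{kvy}y$, $\tilde u=C_{ku}x_k+D_{kuw}w_k+D_{kuy}y$, $w_k=\phi(v_k)$. *)

theory Defs
  imports "HOL-Analysis.Analysis"
begin

section \<open>Matrices\<close>

definition diagonal_matrix :: "real^'n^'n \<Rightarrow> bool" where
  "diagonal_matrix A \<longleftrightarrow> (\<forall>i j. i \<noteq> j \<longrightarrow> A $ i $ j = 0)"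

definition pos_semidef :: "real^'n^'n \<Rightarrow> bool" where
  "pos_semidef A \<longleftrightarrow> transpose A = A \<and> (\<forall>x. 0 \<le> x \<bullet> (A *v x))"

definition pos_def :: "real^'n^'n \<Rightarrow> bool" where
  "pos_def A \<longleftrightarrow> transpose A = A \<and> (\<forall>x. x \<noteq> 0 \<longrightarrow> 0 < x \<bullet> (A *v x))"

definition neg_semidef :: "real^'n^'n \<Rightarrow> bool" where
  "neg_semidef A \<longleftrightarrow> pos_semidef (- A)"

definition block_matrix ::
  "real^'c^'r \<Rightarrow> real^'d^'r \<Rightarrow> real^'c^'s \<Rightarrow> real^'d^'s \<Rightarrow> real^('c + 'd)^('r + 's)" where
  "block_matrix A B C D =
     (\<chi> i j. case i of
        Inl r \<Rightarrow> (case j of Inl c \<Rightarrow> A $ r $ c | Inr d \<Rightarrow> B $ r $ d)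
      | Inr s \<Rightarrow> (case j of Inl c \<Rightarrow> C $ s $ c | Inr d \<Rightarrow> D $ s $ d))"

section \<open>Signals and operators\<close>

text \<open>Signals are functions on the half-line of nonnegative reals; they are represented by total
  functions on the reals, whose values at negative times never matter.\<close>

definition L2e :: "(real \<Rightarrow> 'a::euclidean_space) set" where
  "L2e = {f. \<forall>T>0. set_borel_measurable lebesgue {0..T} f \<and>
                   set_integrable lebesgue {0..T} (\<lambda>t. (norm (f t))\<^sup>2)}"

definition trunc :: "real \<Rightarrow> (real \<Rightarrow> 'a::zero) \<Rightarrow> real \<Rightarrow> 'a" where
  "trunc T v = (\<lambda>t. if t \<in> {0..T} then v t else 0)"

text \<open>Output signals are compared almost everywhere. An operator is not required to send inputs
  that agree almost everywhere to outputs that agree almost everywhere, so both operators on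
  functions and operators on equivalence classes of functions are covered.\<close>

definition causal ::
  "((real \<Rightarrow> 'a::euclidean_space) \<Rightarrow> real \<Rightarrow> 'b::euclidean_space) \<Rightarrow> bool" where
  "causal \<Delta> \<longleftrightarrow>
     (\<forall>v\<in>L2e. \<forall>T\<ge>0. AE t in lebesgue. t \<in> {0..T} \<longrightarrow> \<Delta> v t = \<Delta> (trunc T v) t)"

definition diagonal_operator :: "((real \<Rightarrow> real^'n) \<Rightarrow> real \<Rightarrow> real^'n) \<Rightarrow> bool" where
  "diagonal_operator \<Delta> \<longleftrightarrow>
     (\<exists>\<delta> :: 'n \<Rightarrow> (real \<Rightarrow> real) \<Rightarrow> real \<Rightarrow> real.
        \<forall>v\<in>L2e. \<forall>i. AE t in lebesgue. 0 \<le> t \<longrightarrow> \<Delta> v t $ i = \<delta> i (\<lambda>s. v s $ i) t)"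

definition L2_gain_less ::
  "real \<Rightarrow> ((real \<Rightarrow> 'a::euclidean_space) \<Rightarrow> real \<Rightarrow> 'b::euclidean_space) \<Rightarrow> bool" where
  "L2_gain_less \<alpha> \<Delta> \<longleftrightarrow>
     (\<exists>\<gamma>. 0 \<le> \<gamma> \<and> \<gamma> < \<alpha> \<and>
        (\<forall>v\<in>L2e. \<forall>T\<ge>0. (LINT t:{0..T}|lebesgue. (norm (\<Delta> v t))\<^sup>2)
                      \<le> \<gamma>\<^sup>2 * (LINT t:{0..T}|lebesgue. (norm (v t))\<^sup>2)))"

definition uncertainties :: "real \<Rightarrow> ((real \<Rightarrow> real^'nu) \<Rightarrow> real \<Rightarrow> real^'nu) set" where
  "uncertainties \<alpha> =
     {\<Delta>. (\<forall>v\<in>L2e. \<Delta> v \<in> L2e) \<and> causal \<Delta> \<and> diagonal_operator \<Delta> \<and> L2_gain_less \<alpha> \<Delta>}"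

section \<open>Activation functions\<close>

definition sector_bounded_01 :: "(real \<Rightarrow> real) \<Rightarrow> bool" where
  "sector_bounded_01 f \<longleftrightarrow> (\<forall>s. f s * (s - f s) \<ge> 0)"

definition slope_restricted_01 :: "(real \<Rightarrow> real) \<Rightarrow> bool" where
  "slope_restricted_01 f \<longleftrightarrow>
     (\<forall>a b. a \<noteq> b \<longrightarrow> 0 \<le> (f a - f b) / (a - b) \<and> (f a - f b) / (a - b) \<le> 1)"

definition activation :: "(real^'n \<Rightarrow> real^'n) \<Rightarrow> bool" where
  "activation \<phi> \<longleftrightarrow>
     (\<exists>f :: 'n \<Rightarrow> real \<Rightarrow> real. (\<forall>v i. \<phi> v $ i = f i (v $ i)) \<and>
        (\<forall>i. sector_bounded_01 (f i) \<and> slope_restricted_01 (f i)))"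

section \<open>Absolute continuity\<close>

text \<open>The usual epsilon-delta definition: a finite family \<open>d\<close> of nonoverlapping compact
  intervals in \<open>S\<close> is a division of its own union, and \<open>Inf k\<close>, \<open>Sup k\<close> are the endpoints
  of the interval \<open>k\<close>.\<close>

definition abs_continuous_on :: "real set \<Rightarrow> (real \<Rightarrow> 'a::real_normed_vector) \<Rightarrow> bool" where
  "abs_continuous_on S f \<longleftrightarrow>
     (\<forall>\<epsilon>>0. \<exists>\<delta>>0. \<forall>d. d division_of \<Union>d \<and> \<Union>d \<subseteq> S \<and> (\<Sum>k\<in>d. Sup k - Inf k) < \<delta>
        \<longrightarrow> (\<Sum>k\<in>d. norm (f (Sup k) - f (Inf k))) < \<epsilon>)"

text \<open>On the unbounded half-line, absolute continuity is understood locally, as is usual for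
  solutions of differential equations.\<close>

definition abs_continuous_halfline :: "(real \<Rightarrow> 'a::real_normed_vector) \<Rightarrow> bool" where
  "abs_continuous_halfline f \<longleftrightarrow> (\<forall>T>0. abs_continuous_on {0..T} f)"

section \<open>Plant, controller and closed loop\<close>

record ('np::finite, 'nu::finite, 'ny::finite) plant =
  Ap :: "real^'np^'np"
  Bp :: "real^'nu^'np"
  Cp :: "real^'np^'ny"

record ('nk::finite, 'nphi::finite, 'nu::finite, 'ny::finite) nn_controller =
  Ak :: "real^'nk^'nk"
  Bkw :: "real^'nphi^'nk"
  Bky :: "real^'ny^'nk"
  Ckv :: "real^'nk^'nphi"
  Dkvw :: "real^'nphi^'nphi"
  Dkvy :: "real^'ny^'nphi"
  Cku :: "real^'nk^'nu"
  Dkuw :: "real^'nphi^'nu"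
  Dkuy :: "real^'ny^'nu"
  act :: "real^'nphi \<Rightarrow> real^'nphi"

text \<open>An uncertain plant is the set of its state, input and output trajectories
  \<open>(x\<^sub>p, u', y)\<close>, where \<open>u'\<close> is the perturbed input (\<open>u\<close> with a tilde).\<close>

type_synonym ('np, 'nu, 'ny) system =
  "((real \<Rightarrow> real^'np) \<times> (real \<Rightarrow> real^'nu) \<times> (real \<Rightarrow> real^'ny)) set"

definition uncertain_plant ::
  "('np::finite, 'nu::finite, 'ny::finite) plant \<Rightarrow> real \<Rightarrow>
   ((real \<Rightarrow> real^'nu) \<Rightarrow> real \<Rightarrow> real^'nu) \<Rightarrow> ('np, 'nu, 'ny) system" where
  "uncertain_plant P \<sigma> \<Delta> =
     {(xp, u', y). abs_continuous_halfline xp \<and>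
        (\<exists>u. \<exists>vp\<in>L2e. \<exists>wp\<in>L2e. AE t in lebesgue. 0 \<le> t \<longrightarrow>
           (xp has_vector_derivative (Ap P *v xp t + Bp P *v u t)) (at t within {0..}) \<and>
           y t = Cp P *v xp t \<and>
           u t = vp t + ((1 - \<sigma>) / 2) *\<^sub>R wp t \<and>
           vp t = u' t + ((1 + \<sigma>) / 2) *\<^sub>R wp t \<and>
           wp t = \<Delta> vp t)}"

definition uncertain_plants ::
  "('np::finite, 'nu::finite, 'ny::finite) plant \<Rightarrow> real \<Rightarrow> real \<Rightarrow>
   ('np, 'nu, 'ny) system set" where
  "uncertain_plants P \<alpha> \<sigma> = {uncertain_plant P \<sigma> \<Delta> |\<Delta>. \<Delta> \<in> uncertainties \<alpha>}"

definition closed_loop ::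
  "('np::finite, 'nu::finite, 'ny::finite) system \<Rightarrow>
   ('nk::finite, 'nphi::finite, 'nu, 'ny) nn_controller \<Rightarrow>
   ((real \<Rightarrow> real^'np) \<times> (real \<Rightarrow> real^'nk)) set" where
  "closed_loop S K =
     {(xp, xk). \<exists>u' y. (xp, u', y) \<in> S \<and> abs_continuous_halfline xk \<and>
        (\<exists>vk\<in>L2e. \<exists>wk\<in>L2e. AE t in lebesgue. 0 \<le> t \<longrightarrow>
           (xk has_vector_derivative
              (Ak K *v xk t + Bkw K *v wk t + Bky K *v y t)) (at t within {0..}) \<and>
           vk t = Ckv K *v xk t + Dkvw K *v wk t + Dkvy K *v y t \<and>
           u' t = Cku K *v xk t + Dkuw K *v wk t + Dkuy K *v y t \<and>
           wk t = act K (vk t))}"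

definition lyapunov_stable ::
  "((real \<Rightarrow> 'a::real_normed_vector) \<times> (real \<Rightarrow> 'b::real_normed_vector)) set \<Rightarrow> bool" where
  "lyapunov_stable trajs \<longleftrightarrow>
     (\<forall>\<epsilon>>0. \<exists>\<delta>>0. \<forall>(xp, xk)\<in>trajs.
        norm (xp 0, xk 0) < \<delta> \<longrightarrow> (\<forall>t\<ge>0. norm (xp t, xk t) < \<epsilon>))"

definition satisfies_disk_margin ::
  "('np::finite, 'nu::finite, 'ny::finite) plant \<Rightarrow>
   ('nk::finite, 'nphi::finite, 'nu, 'ny) nn_controller \<Rightarrow> real \<Rightarrow> real \<Rightarrow> bool" where
  "satisfies_disk_margin P K \<alpha> \<sigma> \<longleftrightarrow>
     (\<forall>S\<in>uncertain_plants P \<alpha> \<sigma>. lyapunov_stable (closed_loop S K))"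

section \<open>Matrices of the linear matrix inequality\<close>

definition cl_A ::
  "('np::finite, 'nu::finite, 'ny::finite) plant \<Rightarrow>
   ('nk::finite, 'nphi::finite, 'nu, 'ny) nn_controller \<Rightarrow> real^('np + 'nk)^('np + 'nk)" where
  "cl_A P K = block_matrix
     (Ap P + Bp P ** Dkuy K ** Cp P) (Bp P ** Cku K)
     (Bky K ** Cp P)                 (Ak K)"

definition cl_Bw ::
  "('np::finite, 'nu::finite, 'ny::finite) plant \<Rightarrow>
   ('nk::finite, 'nphi::finite, 'nu, 'ny) nn_controller \<Rightarrow> real^('nu + 'nphi)^('np + 'nk)" where
  "cl_Bw P K = block_matrix
     (Bp P) (Bp P ** Dkuw K)
     0      (Bkw K)"

definition cl_Cv ::
  "('np::finite, 'nu::finite, 'ny::finite) plant \<Rightarrow>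
   ('nk::finite, 'nphi::finite, 'nu, 'ny) nn_controller \<Rightarrow> real^('np + 'nk)^('nu + 'nphi)" where
  "cl_Cv P K = block_matrix
     (Dkuy K ** Cp P) (Cku K)
     (Dkvy K ** Cp P) (Ckv K)"

definition cl_Dvw ::
  "real \<Rightarrow> ('nk::finite, 'nphi::finite, 'nu::finite, 'ny::finite) nn_controller \<Rightarrow>
   real^('nu + 'nphi)^('nu + 'nphi)" where
  "cl_Dvw \<sigma> K = block_matrix
     (((1 + \<sigma>) / 2) *\<^sub>R mat 1) (Dkuw K)
     0                         (Dkvw K)"

definition multiplier ::
  "real \<Rightarrow> real^'nu^'nu \<Rightarrow> real^'nphi^'nphi \<Rightarrow>
   real^(('nu + 'nphi) + ('nu + 'nphi))^(('nu + 'nphi) + ('nu + 'nphi))" where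
  "multiplier \<alpha> \<Lambda>p \<Lambda>k = block_matrix
     (block_matrix (\<alpha>\<^sup>2 *\<^sub>R \<Lambda>p) 0
                   0           0)
     (block_matrix 0 0
                   0 \<Lambda>k)
     (block_matrix 0 0
                   0 \<Lambda>k)
     (block_matrix (- \<Lambda>p) 0
                   0      (- (2 *\<^sub>R \<Lambda>k)))"

end

theory Submission
  imports Defs
begin

text \<open>The function \<open>V(x) = x \<bullet> X x\<close> is a Lyapunov function. Evaluating the matrix inequality at
  \<open>(x, w\<^sub>p, w\<^sub>k)\<close> and dropping the nonnegative sector terms \<open>w\<^sub>k\<^sub>i (v\<^sub>k\<^sub>i - w\<^sub>k\<^sub>i)\<close> gives
  \<open>dV/dt \<le> \<Sum>\<^sub>i \<Lambda>\<^sub>p\<^sub>i (w\<^sub>p\<^sub>i\<^sup>2 - \<alpha>\<^sup>2 v\<^sub>p\<^sub>i\<^sup>2)\<close> almost everywhere along trajectories. The integral of the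
  right-hand side over \<open>[0, T]\<close> is nonpositive because every channel of \<open>\<Delta>\<close> has gain at most \<open>\<alpha>\<close>,
  so \<open>V(x(T)) \<le> V(x(0))\<close>.\<close>

section \<open>Absolutely continuous functions\<close>

lemma abs_continuous_onE:
  assumes "abs_continuous_on S f" "e > 0"
  obtains \<delta> where "\<delta> > 0" "\<And>D. \<lbrakk>D division_of \<Union>D; \<Union>D \<subseteq> S; (\<Sum>k\<in>D. Sup k - Inf k) < \<delta>\<rbrakk>
      \<Longrightarrow> (\<Sum>k\<in>D. norm (f (Sup k) - f (Inf k))) < e"
proof -
  obtain \<delta> where "\<delta> > 0" and \<delta>: "\<forall>D. D division_of \<Union>D \<and> \<Union>D \<subseteq> S \<and> (\<Sum>k\<in>D. Sup k - Inf k) < \<delta>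
        \<longrightarrow> (\<Sum>k\<in>D. norm (f (Sup k) - f (Inf k))) < e"
    using assms(1)[unfolded abs_continuous_on_def, THEN spec, THEN mp, OF assms(2)]
    by (elim exE conjE) (rule that)
  show thesis
    by (rule that[OF \<open>\<delta> > 0\<close>]) (rule \<delta>[rule_format], intro conjI)
qed

text \<open>Fundamental theorem of calculus for the gauge integral, with the integrability of
  \<open>f'\<close> as part of the conclusion. Over a tagged division \<open>f b - f a\<close>
  telescopes, so it suffices to bound the error of each tagged interval.\<close>

lemma abs_continuous_has_integral:
  fixes f :: "real \<Rightarrow> 'a::banach"
  assumes "a \<le> b" and ac: "abs_continuous_on {a..b} f" and N: "negligible N"
    and vecd: "\<And>x. x \<in> {a..b} - N \<Longrightarrow> (f has_vector_derivative f' x) (at x within {a..b})"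
  shows "(f' has_integral (f b - f a)) {a..b}"
proof (cases "a = b")
  case True
  then show ?thesis by auto
next
  case False
  then have "a < b" using \<open>a \<le> b\<close> by simp
  \<comment> \<open>With value 0 on \<open>N\<close>, an interval tagged in \<open>N\<close>
    contributes only the increment of \<open>f\<close> to the error.\<close>
  define g where "g x = (if x \<in> N then 0 else f' x)" for x
  have "(g has_integral (f b - f a)) {a..b}"
    unfolding has_integral_factor_content_real
  proof (intro allI impI)
    fix e :: real
    assume "e > 0"
    \<comment> \<open>The radius \<open>d x\<close> is where the first-order expansion at
      \<open>x\<close> has relative error at most \<open>e/2\<close>. Membership is a premise inside
      the existential, so \<open>d\<close> is positive everywhere.\<close>
    then have "\<forall>x. \<exists>d>0. x \<in> {a..b} - N \<longrightarrow>
         (\<forall>y\<in>{a..b}. norm (y-x) < d \<longrightarrow> norm (f y - f x - (y-x) *\<^sub>R f' x) \<le> e/2 * norm (y-x))"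
      using vecd[unfolded has_vector_derivative_def has_derivative_within_alt]
      by (metis half_gt_zero)
    then obtain d where d: "\<And>x. 0 < d x"
       "\<And>x y. \<lbrakk>x \<in> {a..b} - N; y \<in> {a..b}; norm (y-x) < d x\<rbrakk>
           \<Longrightarrow> norm (f y - f x - (y-x) *\<^sub>R f' x) \<le> e/2 * norm (y-x)"
      by metis
    \<comment> \<open>Half of the error budget \<open>e * (b - a)\<close> goes to the tags in
      \<open>N\<close>, half to the others.\<close>
    have "e/2 * (b - a) > 0"
      using \<open>e > 0\<close> \<open>a < b\<close> by simp
    then obtain \<delta> where "\<delta> > 0" and \<delta>: "\<And>D. \<lbrakk>D division_of \<Union>D; \<Union>D \<subseteq> {a..b}; (\<Sum>k\<in>D. Sup k - Inf k) < \<delta>\<rbrakk>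
        \<Longrightarrow> (\<Sum>k\<in>D. norm (f (Sup k) - f (Inf k))) < e/2 * (b - a)"
      by (rule abs_continuous_onE[OF ac]) blast
    \<comment> \<open>Outer regularity makes \<open>U - N\<close> small, and \<open>N\<close> is
      null, so \<open>U\<close> itself has measure below \<open>\<delta>\<close>.\<close>
    obtain U where U: "open U" "N \<subseteq> U" "U \<in> lmeasurable" "measure lebesgue U < \<delta>"
    proof -
      have null: "N \<in> null_sets lebesgue"
        using N by (simp add: negligible_iff_null_sets)
      obtain U where U: "open U" "N \<subseteq> U" "U - N \<in> lmeasurable" "emeasure lebesgue (U - N) < ennreal \<delta>"
        using sets_lebesgue_outer_open[OF _ \<open>\<delta> > 0\<close>, of N] null by (metis null_setsD2)
      have "U \<in> lmeasurable"
        using U null by (metis borel_open measurable_Diff_null_set sets_completionI_sets sets_lborel)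
      moreover have "measure lebesgue U < \<delta>"
        using U null \<open>U \<in> lmeasurable\<close> \<open>\<delta> > 0\<close>
        by (metis emeasure_eq_measure2 ennreal_less_iff fmeasurableD measure_Diff_null_set measure_nonneg)
      ultimately show thesis using U that by blast
    qed
    \<comment> \<open>Absolute continuity controls the subintervals tagged in the null set \<open>N\<close>, which lie in
      the small open set \<open>U\<close>; at all other tags the derivative does.\<close>
    have "\<forall>x. \<exists>G. open G \<and> x \<in> G \<and> (if x \<in> N then G \<subseteq> U else G \<subseteq> ball x (d x))"
      using U d(1) by (metis centre_in_ball open_ball subset_refl subsetD)
    then obtain G where G: "\<And>x. open (G x)" "\<And>x. x \<in> G x" "\<And>x. x \<in> N \<Longrightarrow> G x \<subseteq> U"
        "\<And>x. x \<notin> N \<Longrightarrow> G x \<subseteq> ball x (d x)"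
      by metis
    show "\<exists>G. gauge G \<and> (\<forall>p. p tagged_division_of {a..b} \<and> G fine p \<longrightarrow>
      norm ((\<Sum>(x, k)\<in>p. measure lborel k *\<^sub>R g x) - (f b - f a)) \<le> e * measure lborel {a..b})"
    proof (intro exI conjI allI impI)
      show "gauge G"
        using G unfolding gauge_def by auto
      fix p
      assume "p tagged_division_of {a..b} \<and> G fine p"
      then have ptag: "p tagged_division_of {a..b}" and finep: "G fine p" by auto
      have "finite p" using ptag by auto
      \<comment> \<open>\<open>q\<close> collects the intervals tagged in \<open>N\<close>;
        \<open>h\<close> is the signed error of one tagged interval, so the total error is
        \<open>sum h p\<close>.\<close>
      define q where "q = {(x,K) \<in> p. x \<in> N}"
      define h where "h = (\<lambda>(x, K). measure lborel K *\<^sub>R g x - (f (Sup K) - f (Inf K)))"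
      have pK: "x \<in> K" "K \<subseteq> {a..b}" "K \<subseteq> G x" "K = {Inf K..Sup K}" "Inf K \<le> Sup K"
          "measure lborel K = Sup K - Inf K" if xK: "(x, K) \<in> p" for x K
      proof -
        obtain u v where uv: "K = {u..v}"
          using tagged_division_ofD(4)[OF ptag xK] by (auto simp: box_real)
        show "x \<in> K" "K \<subseteq> {a..b}"
          using tagged_division_ofD(2,3)[OF ptag xK] by auto
        with uv have "u \<le> v" by auto
        then show "K = {Inf K..Sup K}" "Inf K \<le> Sup K" "measure lborel K = Sup K - Inf K"
          by (auto simp: uv)
        show "K \<subseteq> G x" using fineD[OF finep xK] .
      qed
      have ba: "b - a = (\<Sum>(x,K)\<in>p. Sup K - Inf K)" "f b - f a = (\<Sum>(x,K)\<in>p. f(Sup K) - f(Inf K))"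
        using additive_tagged_division_1[where f= "\<lambda>x. x"] additive_tagged_division_1[where f= f]
            \<open>a \<le> b\<close> ptag by auto
      have "q \<subseteq> p" unfolding q_def by auto
      have qpart: "q tagged_partial_division_of {a..b}"
        using ptag \<open>q \<subseteq> p\<close> by (meson tagged_division_of_def tagged_partial_division_subset)
      have qtag: "q tagged_division_of \<Union>(snd ` q)"
        using qpart by (rule tagged_partial_division_of_Union_self)
      have qdiv: "snd ` q division_of \<Union>(snd ` q)"
        using qpart by (rule partial_division_of_tagged_division)
      have qab: "\<Union>(snd ` q) \<subseteq> {a..b}"
        using pK(2) \<open>q \<subseteq> p\<close> by fastforce
      have qU: "\<Union>(snd ` q) \<subseteq> U"
      proof (clarsimp simp: q_def)
        fix x K y
        assume "(x, K) \<in> p" "x \<in> N" "y \<in> K"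
        then show "y \<in> U" using pK(3) G(3) by blast
      qed
      \<comment> \<open>The intervals do not overlap, so their lengths add up to the measure of
        their union, which lies in \<open>U\<close>.\<close>
      have len: "(\<Sum>k\<in>snd ` q. Sup k - Inf k) < \<delta>"
      proof -
        have "(\<Sum>k\<in>snd ` q. Sup k - Inf k) = (\<Sum>k\<in>snd ` q. measure lebesgue k)"
        proof (rule sum.cong[OF refl])
          fix K
          assume "K \<in> snd ` q"
          then obtain x where "(x, K) \<in> p" using \<open>q \<subseteq> p\<close> by auto
          then show "Sup K - Inf K = measure lebesgue K"
            by (metis pK(4,6) measure_completion sets_lborel atLeastAtMost_borel)
        qed
        also have "\<dots> = measure lebesgue (\<Union>(snd ` q))"
          using content_division[OF qdiv] .
        also have "\<dots> \<le> measure lebesgue U"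
          using qU U qdiv by (intro measure_mono_fmeasurable) (auto intro: lmeasurable_division fmeasurableD)
        finally show ?thesis using U by simp
      qed
      have bad: "norm (sum h q) \<le> e/2 * (b - a)"
      proof -
        have ne: "{} \<notin> snd ` q"
          using pK(1) \<open>q \<subseteq> p\<close> by fastforce
        have "norm (sum h q) \<le> (\<Sum>(x,K)\<in>q. norm (f (Sup K) - f (Inf K)))"
          by (rule sum_norm_le) (auto simp: h_def q_def g_def norm_minus_commute)
        \<comment> \<open>Passing from tagged pairs to bare intervals requires a summand that
          vanishes on every interval with empty interior. One-point intervals do so by themselves;
          \<open>Sup {}\<close> and \<open>Inf {}\<close> have no useful value, hence the explicit
          0.\<close>
        also have "\<dots> = (\<Sum>(x,K)\<in>q. if K = {} then 0 else norm (f (Sup K) - f (Inf K)))"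
          using ne by (intro sum.cong) force+
        also have "\<dots> = (\<Sum>K\<in>snd ` q. if K = {} then 0 else norm (f (Sup K) - f (Inf K)))"
          by (rule sum.over_tagged_division_lemma[OF qtag]) (auto simp: box_real)
        also have "\<dots> = (\<Sum>K\<in>snd ` q. norm (f (Sup K) - f (Inf K)))"
          using ne by (intro sum.cong) auto
        also have "\<dots> < e/2 * (b - a)"
          by (rule \<delta>[OF qdiv qab len])
        finally show ?thesis by simp
      qed
      have "norm (sum h (p - q)) \<le> (\<Sum>(x,K)\<in>p - q. e/2 * (Sup K - Inf K))"
      proof (rule sum_norm_le, safe)
        fix x K
        assume xK: "(x, K) \<in> p" and nq: "(x, K) \<notin> q"
        then have "x \<notin> N" by (auto simp: q_def)
        define u v where "u = Inf K" and "v = Sup K"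
        have uv: "K = {u..v}" "u \<le> v" "x \<in> K" "K \<subseteq> {a..b}" "K \<subseteq> G x" "measure lborel K = v - u"
          using pK[OF xK] by (auto simp: u_def v_def)
        then have mem: "u \<in> K" "v \<in> K" "u \<in> {a..b}" "v \<in> {a..b}" "Sup K = v" "Inf K = u"
          by auto
        have nb: "norm (y - x) < d x" if "y \<in> K" for y
          using subsetD[OF uv(5) that] G(4)[OF \<open>x \<notin> N\<close>]
          by (auto simp: dist_norm norm_minus_commute)
        have x: "x \<in> {a..b} - N" using uv \<open>x \<notin> N\<close> by auto
        \<comment> \<open>Straddle estimate: the expansions of \<open>f\<close> at the tag, taken at
          both endpoints, differ by exactly the error of \<open>K\<close>. Since u \<le> x \<le> v,
          the two distances to the tag add up to the length of \<open>K\<close>.\<close>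
        have "norm (h (x, K)) = norm ((f u - f x - (u - x) *\<^sub>R f' x) - (f v - f x - (v - x) *\<^sub>R f' x))"
          unfolding h_def g_def split_conv uv(6) mem(5,6) using \<open>x \<notin> N\<close> by (simp add: algebra_simps)
        also have "\<dots> \<le> norm (f u - f x - (u - x) *\<^sub>R f' x) + norm (f v - f x - (v - x) *\<^sub>R f' x)"
          by (rule norm_triangle_ineq4)
        also have "\<dots> \<le> e/2 * norm (u - x) + e/2 * norm (v - x)"
          by (intro add_mono d(2)[OF x] nb mem)
        also have "\<dots> = e/2 * (Sup K - Inf K)"
          using uv(1,3) mem(5,6) by (auto simp: field_simps)
        finally show "norm (h (x, K)) \<le> e/2 * (Sup K - Inf K)" .
      qed
      also have "\<dots> \<le> (\<Sum>(x,K)\<in>p. e/2 * (Sup K - Inf K))"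
        using \<open>finite p\<close> \<open>e > 0\<close> by (intro sum_mono2) (auto simp: pK(5))
      also have "\<dots> = e/2 * (b - a)"
        by (simp add: ba(1) sum_distrib_left split_def)
      finally have good: "norm (sum h (p - q)) \<le> e/2 * (b - a)" .
      have "norm (sum h p) \<le> e * (b - a)"
        using norm_triangle_ineq[of "sum h (p - q)" "sum h q"] good bad
          sum.subset_diff[OF \<open>q \<subseteq> p\<close> \<open>finite p\<close>, of h] by (simp add: field_simps)
      moreover have "(\<Sum>(x, k)\<in>p. measure lborel k *\<^sub>R g x) - (f b - f a) = sum h p"
        by (simp add: ba(2) h_def split_def sum_subtractf)
      ultimately show "norm ((\<Sum>(x, k)\<in>p. measure lborel k *\<^sub>R g x) - (f b - f a)) \<le> e * measure lborel {a..b}"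
        using \<open>a \<le> b\<close> by simp
    qed
  qed
  \<comment> \<open>\<open>g\<close> and \<open>f'\<close> differ only on the negligible set
    \<open>N\<close>, which does not affect the integral.\<close>
  then show ?thesis
    by (rule has_integral_spike[OF N, rotated]) (auto simp: g_def)
qed

text \<open>One short interval is a division of itself, so the definition contains uniform
  continuity. This is what bounds trajectories on compact time intervals.\<close>

lemma abs_continuous_on_continuous_on:
  assumes "abs_continuous_on {a..b} f"
  shows "continuous_on {a..b} f"
  unfolding continuous_on_iff
proof (intro ballI allI impI)
  fix x e :: real
  assume x: "x \<in> {a..b}" and "e > 0"
  obtain \<delta> where "\<delta> > 0" and \<delta>: "\<And>D. \<lbrakk>D division_of \<Union>D; \<Union>D \<subseteq> {a..b}; (\<Sum>k\<in>D. Sup k - Inf k) < \<delta>\<rbrakk>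
      \<Longrightarrow> (\<Sum>k\<in>D. norm (f (Sup k) - f (Inf k))) < e"
    by (rule abs_continuous_onE[OF assms \<open>e > 0\<close>]) blast
  have "dist (f y) (f x) < e" if y: "y \<in> {a..b}" "dist y x < \<delta>" for y
  proof -
    have *: "norm (f v - f u) < e" if "u \<le> v" "u \<in> {a..b}" "v \<in> {a..b}" "v - u < \<delta>" for u v
    proof -
      have "{{u..v}} division_of \<Union>{{u..v}}"
        using division_of_self[of u v] that by auto
      from \<delta>[OF this] that show ?thesis by auto
    qed
    show ?thesis
      using *[of x y] *[of y x] x y by (cases "x \<le> y") (auto simp: dist_norm norm_minus_commute)
  qed
  then show "\<exists>d>0. \<forall>x'\<in>{a..b}. dist x' x < d \<longrightarrow> dist (f x') (f x) < e"
    using \<open>\<delta> > 0\<close> by blast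
qed

text \<open>A common bound on the total length controls the sums for \<open>f\<close> and
  \<open>g\<close>, hence the one for \<open>h\<close>. Two dominating functions serve the stacked
  state; the quadratic form uses the same one twice.\<close>

lemma abs_continuous_on_dominated:
  assumes f: "abs_continuous_on S f" and g: "abs_continuous_on S g"
    and le: "\<And>s t. \<lbrakk>s \<in> S; t \<in> S\<rbrakk> \<Longrightarrow> norm (h t - h s) \<le> L * (norm (f t - f s) + norm (g t - g s))"
  shows "abs_continuous_on S h"
  unfolding abs_continuous_on_def
proof (intro allI impI)
  fix e :: real
  assume "e > 0"
  \<comment> \<open>Each of the two sums stays below \<open>e'\<close>; the factor
    \<open>\<bar>L\<bar> + 1\<close> is positive whatever the sign of \<open>L\<close>.\<close>
  define e' where "e' = e / (2 * (\<bar>L\<bar> + 1))"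
  have "e' > 0" using \<open>e > 0\<close> by (simp add: e'_def)
  obtain d1 where d1: "d1 > 0" "\<And>D. \<lbrakk>D division_of \<Union>D; \<Union>D \<subseteq> S; (\<Sum>k\<in>D. Sup k - Inf k) < d1\<rbrakk>
      \<Longrightarrow> (\<Sum>k\<in>D. norm (f (Sup k) - f (Inf k))) < e'"
    by (rule abs_continuous_onE[OF f \<open>e' > 0\<close>]) blast
  obtain d2 where d2: "d2 > 0" "\<And>D. \<lbrakk>D division_of \<Union>D; \<Union>D \<subseteq> S; (\<Sum>k\<in>D. Sup k - Inf k) < d2\<rbrakk>
      \<Longrightarrow> (\<Sum>k\<in>D. norm (g (Sup k) - g (Inf k))) < e'"
    by (rule abs_continuous_onE[OF g \<open>e' > 0\<close>]) blast
  have "(\<Sum>k\<in>D. norm (h (Sup k) - h (Inf k))) < e"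
    if D: "D division_of \<Union>D" "\<Union>D \<subseteq> S" "(\<Sum>k\<in>D. Sup k - Inf k) < min d1 d2" for D
  proof -
    have "norm (h (Sup k) - h (Inf k)) \<le>
        (\<bar>L\<bar> + 1) * (norm (f (Sup k) - f (Inf k)) + norm (g (Sup k) - g (Inf k)))" if kD: "k \<in> D" for k
    proof -
      obtain u v where uv: "k = {u..v}" "u \<le> v"
        using division_ofD(3,4)[OF D(1) kD] by (auto simp: box_real)
      then have "Sup k \<in> k" "Inf k \<in> k"
        by auto
      then have "Sup k \<in> S" "Inf k \<in> S"
        using D(2) kD by blast+
      then have "norm (h (Sup k) - h (Inf k)) \<le> L * (norm (f (Sup k) - f (Inf k)) + norm (g (Sup k) - g (Inf k)))"
        by (intro le)
      also have "\<dots> \<le> (\<bar>L\<bar> + 1) * (norm (f (Sup k) - f (Inf k)) + norm (g (Sup k) - g (Inf k)))"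
        by (intro mult_right_mono) auto
      finally show ?thesis .
    qed
    then have "(\<Sum>k\<in>D. norm (h (Sup k) - h (Inf k))) \<le>
        (\<Sum>k\<in>D. (\<bar>L\<bar> + 1) * (norm (f (Sup k) - f (Inf k)) + norm (g (Sup k) - g (Inf k))))"
      by (rule sum_mono)
    also have "\<dots> = (\<bar>L\<bar> + 1) * ((\<Sum>k\<in>D. norm (f (Sup k) - f (Inf k))) + (\<Sum>k\<in>D. norm (g (Sup k) - g (Inf k))))"
      by (simp only: sum_distrib_left[symmetric] sum.distrib)
    also have "\<dots> < (\<bar>L\<bar> + 1) * (e' + e')"
      using d1(2)[OF D(1,2)] d2(2)[OF D(1,2)] D(3) by (intro mult_strict_left_mono add_strict_mono) auto
    also have "\<dots> = e"
      using abs_ge_zero[of L] unfolding e'_def by (simp add: divide_simps)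
    finally show ?thesis .
  qed
  then show "\<exists>\<delta>>0. \<forall>D. D division_of \<Union>D \<and> \<Union>D \<subseteq> S \<and> (\<Sum>k\<in>D. Sup k - Inf k) < \<delta>
        \<longrightarrow> (\<Sum>k\<in>D. norm (h (Sup k) - h (Inf k))) < e"
    using d1(1) d2(1) by (intro exI[of _ "min d1 d2"]) auto
qed

section \<open>Block vectors and quadratic forms\<close>

definition block_vec :: "real^'a \<Rightarrow> real^'b \<Rightarrow> real^('a + 'b)" where
  "block_vec x y = (\<chi> i. case i of Inl a \<Rightarrow> x $ a | Inr b \<Rightarrow> y $ b)"

lemma block_vec_nth [simp]: "block_vec x y $ Inl a = x $ a" "block_vec x y $ Inr b = y $ b"
  by (simp_all add: block_vec_def)

lemma block_vec_add: "block_vec x y + block_vec x' y' = block_vec (x + x') (y + y')"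
  and block_vec_diff: "block_vec x y - block_vec x' y' = block_vec (x - x') (y - y')"
  and block_vec_scaleR: "c *\<^sub>R block_vec x y = block_vec (c *\<^sub>R x) (c *\<^sub>R y)"
  by (simp_all add: vec_eq_iff block_vec_def split: sum.split)

lemma sum_UNIV_Plus:
  fixes f :: "'a::finite + 'b::finite \<Rightarrow> 'c::comm_monoid_add"
  shows "sum f UNIV = (\<Sum>a\<in>UNIV. f (Inl a)) + (\<Sum>b\<in>UNIV. f (Inr b))"
  using sum.Plus[of "UNIV :: 'a set" "UNIV :: 'b set" f] by (simp add: UNIV_Plus_UNIV o_def)

lemma inner_block_vec: "block_vec x y \<bullet> block_vec x' y' = x \<bullet> x' + y \<bullet> y'"
  for x x' :: "real^'a::finite" and y y' :: "real^'b::finite"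
  by (simp add: inner_vec_def sum_UNIV_Plus)

text \<open>Connects the stacked state, on which the matrices act, with the pair of states measured
  in \<open>lyapunov_stable\<close>.\<close>

lemma norm_block_vec: "norm (block_vec x y) = norm (x, y)"
  for x :: "real^'a::finite" and y :: "real^'b::finite"
  by (simp add: norm_eq_sqrt_inner inner_block_vec)

lemma block_matrix_vector_mult:
  fixes A :: "real^'c::finite^'r" and B :: "real^'d::finite^'r"
    and C :: "real^'c::finite^'s" and D :: "real^'d::finite^'s"
  shows "block_matrix A B C D *v block_vec x y = block_vec (A *v x + B *v y) (C *v x + D *v y)"
  by (simp add: vec_eq_iff block_vec_def block_matrix_def matrix_vector_mult_def sum_UNIV_Plus split: sum.split)

lemma bounded_linear_block_vec: "bounded_linear (\<lambda>z. block_vec (fst z) (snd z))"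
  by (rule bounded_linear_intro[where K=1])
    (auto simp: block_vec_add block_vec_scaleR norm_block_vec)

lemma has_vector_derivative_block_vec:
  fixes x :: "real \<Rightarrow> real^'a::finite" and y :: "real \<Rightarrow> real^'b::finite"
  assumes "(x has_vector_derivative x') (at t within S)" "(y has_vector_derivative y') (at t within S)"
  shows "((\<lambda>t. block_vec (x t) (y t)) has_vector_derivative block_vec x' y') (at t within S)"
  using bounded_linear.has_vector_derivative[OF bounded_linear_block_vec has_vector_derivative_Pair[OF assms]]
  by simp

lemma matrix_vector_mult_minus_left: "(- A) *v x = - (A *v x)" for A :: "real^'n^'m"
  using matrix_vector_mult_diff_rdistrib[of 0 A x] by simp

section \<open>Diagonal, semidefinite and definite matrices\<close>

lemma inner_diagonal_matrix:
  assumes "diagonal_matrix L"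
  shows "u \<bullet> (L *v w) = (\<Sum>i\<in>UNIV. L $ i $ i * (u $ i * w $ i))"
proof -
  have "(L *v w) $ i = L $ i $ i * w $ i" for i
  proof -
    have "(L *v w) $ i = (\<Sum>j\<in>UNIV. if j = i then L $ i $ i * w $ i else 0)"
      using assms unfolding matrix_vector_mult_def vec_lambda_beta
      by (intro sum.cong) (auto simp: diagonal_matrix_def)
    then show ?thesis by simp
  qed
  then show ?thesis
    by (simp add: inner_vec_def mult_ac)
qed

lemma pos_semidef_diag_nonneg:
  assumes "pos_semidef L"
  shows "0 \<le> L $ i $ i"
proof -
  have "0 \<le> axis i 1 \<bullet> (L *v axis i 1)"
    using assms unfolding pos_semidef_def by blast
  then show ?thesis
    by (simp add: inner_axis' matrix_vector_mul_component inner_axis)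
qed

text \<open>The form attains a positive minimum and a maximum on the compact unit sphere;
  homogeneity of degree two carries both bounds to all vectors.\<close>

lemma pos_def_bounds:
  fixes X :: "real^'n::finite^'n"
  assumes "pos_def X"
  obtains c C where "0 < c" "0 < C" "\<And>x. c * (norm x)\<^sup>2 \<le> x \<bullet> (X *v x)" "\<And>x. x \<bullet> (X *v x) \<le> C * (norm x)\<^sup>2"
proof -
  let ?q = "\<lambda>x. x \<bullet> (X *v x)"
  let ?S = "sphere (0::real^'n) 1"
  have cont: "continuous_on ?S ?q"
    by (intro continuous_intros matrix_vector_mult_linear_continuous_on)
  have ne: "?S \<noteq> {}"
    by simp
  obtain a where a: "a \<in> ?S" "\<And>y. y \<in> ?S \<Longrightarrow> ?q a \<le> ?q y"
    using continuous_attains_inf[OF compact_sphere ne cont] by blast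
  obtain b where b: "b \<in> ?S" "\<And>y. y \<in> ?S \<Longrightarrow> ?q y \<le> ?q b"
    using continuous_attains_sup[OF compact_sphere ne cont] by blast
  have pos: "0 < ?q x" if "x \<in> ?S" for x
    using assms that unfolding pos_def_def by (metis norm_zero mem_sphere_0 zero_neq_one)
  have scale: "?q x = (norm x)\<^sup>2 * ?q (x /\<^sub>R norm x)" if "x \<noteq> 0" for x
    using that by (simp add: matrix_vector_mult_scaleR power2_eq_square field_simps)
  show thesis
  proof (rule that[of "?q a" "?q b"])
    show "0 < ?q a" "0 < ?q b" using pos a b by auto
    fix x
    show "?q a * (norm x)\<^sup>2 \<le> ?q x"
      using a(2)[of "x /\<^sub>R norm x"] scale[of x] by (cases "x = 0") (auto simp: mult.commute intro!: mult_left_mono)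
    show "?q x \<le> ?q b * (norm x)\<^sup>2"
      using b(2)[of "x /\<^sub>R norm x"] scale[of x] by (cases "x = 0") (auto simp: mult.commute intro!: mult_left_mono)
  qed
qed

lemma pos_def_inner_commute:
  assumes "pos_def X"
  shows "x \<bullet> (X *v y) = y \<bullet> (X *v x)"
  using assms unfolding pos_def_def
  by (metis dot_lmul_matrix inner_commute transpose_matrix_vector)

text \<open>The left-hand side is the quadratic form of the matrix inequality at
  \<open>(x, wp, wk)\<close>. The first block matrix yields twice the inner product with the vector
  field; by the hypothesis \<open>v\<close> the outer factor sends this vector to
  \<open>(vp, vk, wp, wk)\<close>, where the diagonal weights split the multiplier into
  channels.\<close>

lemma matrix_inequality_dissipation:
  fixes P :: "('np::finite, 'nu::finite, 'ny::finite) plant"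
    and K :: "('nk::finite, 'nphi::finite, 'nu, 'ny) nn_controller"
  assumes X: "pos_def X" and Lp: "diagonal_matrix \<Lambda>p" and Lk: "diagonal_matrix \<Lambda>k"
    and neg: "neg_semidef
             (block_matrix
                (transpose (cl_A P K) ** X + X ** cl_A P K) (X ** cl_Bw P K)
                (transpose (cl_Bw P K) ** X)                0
              + transpose (block_matrix (cl_Cv P K) (cl_Dvw \<sigma> K) 0 (mat 1))
                ** multiplier \<alpha> \<Lambda>p \<Lambda>k
                ** block_matrix (cl_Cv P K) (cl_Dvw \<sigma> K) 0 (mat 1))"
    and v: "cl_Cv P K *v x + cl_Dvw \<sigma> K *v block_vec wp wk = block_vec vp vk"
  shows "2 * (x \<bullet> (X *v (cl_A P K *v x + cl_Bw P K *v block_vec wp wk)))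
     + (\<Sum>i\<in>UNIV. \<Lambda>p $ i $ i * (\<alpha>\<^sup>2 * (vp $ i)\<^sup>2 - (wp $ i)\<^sup>2))
     + 2 * (\<Sum>i\<in>UNIV. \<Lambda>k $ i $ i * (wk $ i * (vk $ i - wk $ i))) \<le> 0"
proof -
  define w where "w = block_vec wp wk"
  define z where "z = block_vec x w"
  let ?A = "cl_A P K" and ?B = "cl_Bw P K"
  let ?E = "block_matrix (cl_Cv P K) (cl_Dvw \<sigma> K) 0 (mat 1)"
  let ?Q = "block_matrix (transpose ?A ** X + X ** ?A) (X ** ?B) (transpose ?B ** X) 0"
  let ?M = "multiplier \<alpha> \<Lambda>p \<Lambda>k"
  \<comment> \<open>Moving transposes to the other argument turns the congruence by
    \<open>?E\<close> into the form of \<open>?M\<close> at \<open>?E *v z\<close>.\<close>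
  have tr: "u \<bullet> (transpose N *v y) = (N *v u) \<bullet> y" for N :: "real^'e::finite^'f::finite" and u y
    by (metis dot_lmul_matrix inner_commute transpose_matrix_vector transpose_transpose)
  have mv: "(N ** N') *v u = N *v (N' *v u)" for N :: "real^'e::finite^'f::finite" and N' :: "real^'g::finite^'e::finite" and u
    by (simp add: matrix_vector_mul_assoc)
  have "0 \<le> z \<bullet> (- (?Q + transpose ?E ** ?M ** ?E) *v z)"
    using neg unfolding neg_semidef_def pos_semidef_def by blast
  then have "z \<bullet> (?Q *v z) + (?E *v z) \<bullet> (?M *v (?E *v z)) \<le> 0"
    unfolding matrix_vector_mult_minus_left matrix_vector_mult_add_rdistrib mv inner_minus_right
      inner_add_right tr by simp
  moreover have "z \<bullet> (?Q *v z) = 2 * (x \<bullet> (X *v (?A *v x + ?B *v w)))"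
  proof -
    \<comment> \<open>Symmetry of \<open>X\<close> makes each transposed term equal to its
      untransposed partner, which gives the factor 2.\<close>
    have sym: "(N *v u) \<bullet> (X *v x) = x \<bullet> (X *v (N *v u))" for N :: "real^'e::finite^('np + 'nk)" and u
      by (rule pos_def_inner_commute[OF X])
    have "z \<bullet> (?Q *v z) = x \<bullet> (transpose ?A *v (X *v x)) + x \<bullet> (X *v (?A *v x)) + x \<bullet> (X *v (?B *v w))
        + w \<bullet> (transpose ?B *v (X *v x))"
      unfolding z_def block_matrix_vector_mult inner_block_vec matrix_vector_mult_add_rdistrib
        inner_add_right mv by simp
    then show ?thesis
      unfolding tr sym matrix_vector_right_distrib inner_add_right by simp
  qed
  moreover have "?E *v z = block_vec (block_vec vp vk) (block_vec wp wk)"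
    using v by (simp add: z_def w_def block_matrix_vector_mult)
  moreover have "block_vec (block_vec vp vk) (block_vec wp wk) \<bullet>
      (?M *v block_vec (block_vec vp vk) (block_vec wp wk)) =
      (\<Sum>i\<in>UNIV. \<Lambda>p $ i $ i * (\<alpha>\<^sup>2 * (vp $ i)\<^sup>2 - (wp $ i)\<^sup>2))
     + 2 * (\<Sum>i\<in>UNIV. \<Lambda>k $ i $ i * (wk $ i * (vk $ i - wk $ i)))"
  proof -
    have "(\<Sum>i\<in>UNIV. \<Lambda>p $ i $ i * (\<alpha>\<^sup>2 * (vp $ i)\<^sup>2 - (wp $ i)\<^sup>2)) =
        \<alpha>\<^sup>2 * (vp \<bullet> (\<Lambda>p *v vp)) - wp \<bullet> (\<Lambda>p *v wp)"
      unfolding inner_diagonal_matrix[OF Lp] sum_distrib_left sum_subtractf[symmetric]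
      by (intro sum.cong) (simp_all add: power2_eq_square algebra_simps)
    moreover have "(\<Sum>i\<in>UNIV. \<Lambda>k $ i $ i * (wk $ i * (vk $ i - wk $ i))) =
        wk \<bullet> (\<Lambda>k *v vk) - wk \<bullet> (\<Lambda>k *v wk)"
      unfolding inner_diagonal_matrix[OF Lk] sum_subtractf[symmetric]
      by (intro sum.cong) (simp_all add: algebra_simps)
    \<comment> \<open>The two off-diagonal blocks of the multiplier thus contribute equally,
      matching the factor 2 in its last block.\<close>
    moreover have "vk \<bullet> (\<Lambda>k *v wk) = wk \<bullet> (\<Lambda>k *v vk)"
      unfolding inner_diagonal_matrix[OF Lk] by (simp add: mult.commute)
    ultimately show ?thesis
      by (simp add: multiplier_def block_matrix_vector_mult block_vec_add inner_block_vec
          scaleR_matrix_vector_assoc[symmetric] matrix_vector_mult_minus_left inner_add_right inner_diff_right)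
  qed
  ultimately show ?thesis
    by (simp add: w_def)
qed

section \<open>Signals in \<open>L2e\<close>\<close>

lemma L2e_set_integrable:
  assumes "v \<in> L2e" "0 < T"
  shows "set_integrable lebesgue {0..T} (\<lambda>t. (norm (v t))\<^sup>2)"
  using assms by (simp add: L2e_def)

text \<open>Continuity of \<open>f\<close> gives measurability and its operator bound gives a
  square-integrable majorant. It is needed for single channels and for signals supported on one
  channel.\<close>

lemma L2e_bounded_linear:
  fixes f :: "'a::euclidean_space \<Rightarrow> 'b::euclidean_space"
  assumes "bounded_linear f" "v \<in> L2e"
  shows "(\<lambda>t. f (v t)) \<in> L2e"
  unfolding L2e_def
proof (intro CollectI allI impI conjI)
  interpret f: bounded_linear f by fact
  fix T :: real
  assume "0 < T"
  then have v: "set_borel_measurable lebesgue {0..T} v" "set_integrable lebesgue {0..T} (\<lambda>t. (norm (v t))\<^sup>2)"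
    using assms(2) by (auto simp: L2e_def)
  have "f \<in> borel_measurable borel"
    by (intro borel_measurable_continuous_onI f.continuous_on continuous_intros)
  with v(1) have "(\<lambda>t. f (indicat_real {0..T} t *\<^sub>R v t)) \<in> borel_measurable lebesgue"
    unfolding set_borel_measurable_def by (rule measurable_compose)
  then show fv: "set_borel_measurable lebesgue {0..T} (\<lambda>t. f (v t))"
    by (simp add: set_borel_measurable_def f.scaleR)
  obtain B where B: "\<And>x. norm (f x) \<le> norm x * B"
    using f.bounded by blast
  have "(\<lambda>t. (norm (indicat_real {0..T} t *\<^sub>R f (v t)))\<^sup>2) \<in> borel_measurable lebesgue"
    using fv unfolding set_borel_measurable_def by measurable
  \<comment> \<open>The indicator takes only the values 0 and 1, so squaring leaves it
    unchanged.\<close>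
  moreover have "(norm (indicat_real {0..T} t *\<^sub>R f (v t)))\<^sup>2 = indicat_real {0..T} t *\<^sub>R (norm (f (v t)))\<^sup>2" for t
    by (simp add: indicator_def)
  ultimately have "set_borel_measurable lebesgue {0..T} (\<lambda>t. (norm (f (v t)))\<^sup>2)"
    by (simp add: set_borel_measurable_def)
  moreover have "norm ((norm (f (v t)))\<^sup>2) \<le> norm (B\<^sup>2 * (norm (v t))\<^sup>2)" for t
    using power_mono[OF B[of "v t"], of 2] by (simp add: power_mult_distrib mult.commute)
  moreover have "set_integrable lebesgue {0..T} (\<lambda>t. B\<^sup>2 * (norm (v t))\<^sup>2)"
    using v(2) by simp
  ultimately show "set_integrable lebesgue {0..T} (\<lambda>t. (norm (f (v t)))\<^sup>2)"
    by (auto intro: set_integrable_bound)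
qed

lemma L2e_component_set_integrable:
  fixes v :: "real \<Rightarrow> real^'n"
  assumes "v \<in> L2e" "0 < T"
  shows "set_integrable lebesgue {0..T} (\<lambda>t. (v t $ i)\<^sup>2)"
  using L2e_set_integrable[OF L2e_bounded_linear[OF bounded_linear_vec_nth assms(1)] assms(2), of i] by simp

lemma norm_axis_real: "norm (axis i c) = \<bar>c\<bar>" for c :: real
  by (simp add: norm_eq_sqrt_inner inner_axis_axis)

lemma L2e_axis:
  fixes v :: "real \<Rightarrow> real^'n"
  assumes "v \<in> L2e"
  shows "(\<lambda>t. axis i (v t $ i)) \<in> L2e"
proof (rule L2e_bounded_linear[OF _ assms])
  show "bounded_linear (\<lambda>x::real^'n. axis i (x $ i))"
  proof (rule bounded_linear_intro[where K=1])
    show "norm (axis i (x $ i)) \<le> norm x * 1" for x :: "real^'n"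
      by (simp add: norm_axis_real component_le_norm_cart)
  qed (auto simp: vec_eq_iff axis_def)
qed

lemma uncertainty_channel_gain:
  assumes "\<Delta> \<in> uncertainties \<alpha>" "v \<in> L2e" "0 < T"
  shows "(LINT t:{0..T}|lebesgue. (\<Delta> v t $ i)\<^sup>2) \<le> \<alpha>\<^sup>2 * (LINT t:{0..T}|lebesgue. (v t $ i)\<^sup>2)"
proof -
  \<comment> \<open>Diagonality turns the gain of \<open>\<Delta>\<close> into a gain of each channel: feed in channel \<open>i\<close> alone.\<close>
  define v' where "v' = (\<lambda>t. axis i (v t $ i))"
  have "v' \<in> L2e"
    unfolding v'_def using assms(2) by (rule L2e_axis)
  have \<Delta>: "\<Delta> v \<in> L2e" "\<Delta> v' \<in> L2e"
    using assms \<open>v' \<in> L2e\<close> by (auto simp: uncertainties_def)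
  obtain \<delta> where \<delta>: "\<And>v i. v \<in> L2e \<Longrightarrow> AE t in lebesgue. 0 \<le> t \<longrightarrow> \<Delta> v t $ i = \<delta> i (\<lambda>s. v s $ i) t"
    using assms(1) unfolding uncertainties_def diagonal_operator_def by blast
  \<comment> \<open>Channel \<open>i\<close> of both inputs is the same scalar signal, so
    \<open>\<delta> i\<close> produces the same output for both.\<close>
  have v'_nth: "(\<lambda>s. v' s $ i) = (\<lambda>s. v s $ i)"
    by (simp add: v'_def)
  have ae: "AE t\<in>{0..T} in lebesgue. (\<Delta> v t $ i)\<^sup>2 \<le> (norm (\<Delta> v' t))\<^sup>2"
    using \<delta>[OF assms(2), of i] \<delta>[OF \<open>v' \<in> L2e\<close>, of i]
  proof eventually_elim
    case (elim t)
    then show ?case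
      unfolding v'_nth using component_le_norm_cart[of "\<Delta> v' t" i]
      by (auto simp: abs_le_square_iff[symmetric])
  qed
  obtain \<gamma> where \<gamma>: "0 \<le> \<gamma>" "\<gamma> < \<alpha>" "\<And>v T. \<lbrakk>v \<in> L2e; 0 \<le> T\<rbrakk> \<Longrightarrow>
      (LINT t:{0..T}|lebesgue. (norm (\<Delta> v t))\<^sup>2) \<le> \<gamma>\<^sup>2 * (LINT t:{0..T}|lebesgue. (norm (v t))\<^sup>2)"
    using assms(1) unfolding uncertainties_def L2_gain_less_def by blast
  have "(LINT t:{0..T}|lebesgue. (\<Delta> v t $ i)\<^sup>2) \<le> (LINT t:{0..T}|lebesgue. (norm (\<Delta> v' t))\<^sup>2)"
    by (intro set_integral_mono_AE L2e_component_set_integrable L2e_set_integrable \<Delta> assms ae)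
  also have "\<dots> \<le> \<gamma>\<^sup>2 * (LINT t:{0..T}|lebesgue. (norm (v' t))\<^sup>2)"
    using \<gamma>(3)[OF \<open>v' \<in> L2e\<close>] assms(3) by simp
  also have "\<dots> = \<gamma>\<^sup>2 * (LINT t:{0..T}|lebesgue. (v t $ i)\<^sup>2)"
    by (simp add: v'_def norm_axis_real)
  \<comment> \<open>Monotonicity of squaring uses 0 \<le> \<gamma> < \<alpha>; the remaining
    integral is nonnegative.\<close>
  also have "\<dots> \<le> \<alpha>\<^sup>2 * (LINT t:{0..T}|lebesgue. (v t $ i)\<^sup>2)"
    using \<gamma>(1,2) by (intro mult_right_mono power_mono)
      (auto simp: set_lebesgue_integral_def intro!: Bochner_Integration.integral_nonneg)
  finally show ?thesis .
qed

section \<open>The storage function along closed-loop trajectories\<close>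

lemma activation_sector:
  assumes "activation \<phi>"
  shows "0 \<le> \<phi> v $ i * (v $ i - \<phi> v $ i)"
  using assms unfolding activation_def sector_bounded_01_def by metis

text \<open>By symmetry of \<open>X\<close> the increment factors as
  \<open>(x t - x s) \<bullet> (X *v (x t + x s))\<close>, and \<open>x\<close> is bounded on the
  compact interval, so the form is Lipschitz along the trajectory.\<close>

lemma abs_continuous_on_quadratic_form:
  fixes x :: "real \<Rightarrow> real^'n::finite"
  assumes "pos_def X" and x: "abs_continuous_on {a..b} x"
  shows "abs_continuous_on {a..b} (\<lambda>t. x t \<bullet> (X *v x t))"
proof -
  have "compact (x ` {a..b})"
    using abs_continuous_on_continuous_on[OF x] by (rule compact_continuous_image) simp
  then obtain R where R: "\<And>t. t \<in> {a..b} \<Longrightarrow> norm (x t) \<le> R"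
    by (meson bounded_iff compact_imp_bounded imageI)
  obtain B where B: "0 \<le> B" "\<And>z. norm (X *v z) \<le> norm z * B"
    using bounded_linear.nonneg_bounded[OF matrix_vector_mul_bounded_linear, of X] by blast
  show ?thesis
  proof (rule abs_continuous_on_dominated[OF x x])
    fix s t
    assume st: "s \<in> {a..b}" "t \<in> {a..b}"
    have "x t \<bullet> (X *v x t) - x s \<bullet> (X *v x s) = (x t - x s) \<bullet> (X *v (x t + x s))"
      using pos_def_inner_commute[OF assms(1), of "x t" "x s"]
      by (simp add: matrix_vector_right_distrib inner_add_right inner_diff_left)
    then have "norm (x t \<bullet> (X *v x t) - x s \<bullet> (X *v x s)) \<le> norm (x t - x s) * norm (X *v (x t + x s))"
      using Cauchy_Schwarz_ineq2 by simp
    also have "\<dots> \<le> norm (x t - x s) * (2 * R * B)"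
    proof (rule mult_left_mono)
      have "norm (x t + x s) \<le> 2 * R"
        using norm_triangle_ineq[of "x t" "x s"] R[OF st(1)] R[OF st(2)] by simp
      then show "norm (X *v (x t + x s)) \<le> 2 * R * B"
        using B by (meson mult_right_mono order_trans)
    qed simp
    finally show "norm (x t \<bullet> (X *v x t) - x s \<bullet> (X *v x s)) \<le>
        R * B * (norm (x t - x s) + norm (x t - x s))"
      by (simp add: mult_ac)
  qed
qed

text \<open>Product rule; the two resulting terms coincide by symmetry of \<open>X\<close>.\<close>

lemma has_vector_derivative_quadratic_form:
  fixes x :: "real \<Rightarrow> real^'n::finite"
  assumes "pos_def X" and "(x has_vector_derivative x') (at t within S)"
  shows "((\<lambda>t. x t \<bullet> (X *v x t)) has_vector_derivative 2 * (x t \<bullet> (X *v x'))) (at t within S)"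
proof -
  have "((\<lambda>t. X *v x t) has_vector_derivative X *v x') (at t within S)"
    using bounded_linear.has_vector_derivative[OF matrix_vector_mul_bounded_linear assms(2)] .
  from bounded_bilinear.has_vector_derivative[OF bounded_bilinear_inner assms(2) this]
  show ?thesis
    using pos_def_inner_commute[OF assms(1), of "x t" x'] by simp
qed

lemma abs_continuous_halfline_block_vec:
  fixes x :: "real \<Rightarrow> real^'a::finite" and y :: "real \<Rightarrow> real^'b::finite"
  assumes "abs_continuous_halfline x" "abs_continuous_halfline y" "0 < T"
  shows "abs_continuous_on {0..T} (\<lambda>t. block_vec (x t) (y t))"
proof (rule abs_continuous_on_dominated)
  show "abs_continuous_on {0..T} x" "abs_continuous_on {0..T} y"
    using assms by (auto simp: abs_continuous_halfline_def)
  show "norm (block_vec (x t) (y t) - block_vec (x s) (y s)) \<le> 1 * (norm (x t - x s) + norm (y t - y s))" for s t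
    unfolding block_vec_diff norm_block_vec mult_1 by (rule norm_Pair_le)
qed

text \<open>Eliminating \<open>y\<close>, \<open>u\<close> and \<open>u'\<close> leaves a linear
  system in the stacked state driven by \<open>(wp, wk)\<close>, the form in which the matrix
  inequality is stated.\<close>

lemma closed_loop_dynamics:
  fixes P :: "('np::finite, 'nu::finite, 'ny::finite) plant"
    and K :: "('nk::finite, 'nphi::finite, 'nu, 'ny) nn_controller"
  assumes "y = Cp P *v xp" "u = vp + ((1 - \<sigma>) / 2) *\<^sub>R wp" "vp = u' + ((1 + \<sigma>) / 2) *\<^sub>R wp"
    and "vk = Ckv K *v xk + Dkvw K *v wk + Dkvy K *v y"
    and "u' = Cku K *v xk + Dkuw K *v wk + Dkuy K *v y"
  shows "block_vec (Ap P *v xp + Bp P *v u) (Ak K *v xk + Bkw K *v wk + Bky K *v y)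
      = cl_A P K *v block_vec xp xk + cl_Bw P K *v block_vec wp wk"
    and "cl_Cv P K *v block_vec xp xk + cl_Dvw \<sigma> K *v block_vec wp wk = block_vec vp vk"
proof -
  have mv: "(N ** N') *v z = N *v (N' *v z)" for N :: "real^'e::finite^'f::finite" and N' :: "real^'g::finite^'e::finite" and z
    by (simp add: matrix_vector_mul_assoc)
  \<comment> \<open>The two coefficients of \<open>wp\<close> sum to 1, so the skew \<sigma>
    disappears from the state equation and survives only in \<open>cl_Dvw\<close>.\<close>
  have "u = u' + wp"
    unfolding assms(2,3) by (simp add: add.assoc flip: scaleR_add_left) (simp add: field_simps)
  then show "block_vec (Ap P *v xp + Bp P *v u) (Ak K *v xk + Bkw K *v wk + Bky K *v y)
      = cl_A P K *v block_vec xp xk + cl_Bw P K *v block_vec wp wk"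
    unfolding assms(1,5) cl_A_def cl_Bw_def block_matrix_vector_mult block_vec_add
      matrix_vector_mult_add_rdistrib mv
    by (simp add: matrix_vector_right_distrib add_ac)
  show "cl_Cv P K *v block_vec xp xk + cl_Dvw \<sigma> K *v block_vec wp wk = block_vec vp vk"
    unfolding assms(1,3,4,5) cl_Cv_def cl_Dvw_def block_matrix_vector_mult block_vec_add mv
      scaleR_matrix_vector_assoc[symmetric] matrix_vector_mul_lid
    by (simp add: add_ac)
qed

theorem mainTheorem1:
  fixes P :: "('np::finite, 'nu::finite, 'ny::finite) plant"
    and K :: "('nk::finite, 'nphi::finite, 'nu, 'ny) nn_controller"
    and \<alpha> \<sigma> :: real
  assumes "0 \<le> \<alpha>"
    and "activation (act K)"
    and "\<exists>(X :: real^('np + 'nk)^('np + 'nk)) (\<Lambda>p :: real^'nu^'nu) (\<Lambda>k :: real^'nphi^'nphi).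
           pos_def X \<and>
           diagonal_matrix \<Lambda>p \<and> pos_semidef \<Lambda>p \<and>
           diagonal_matrix \<Lambda>k \<and> pos_semidef \<Lambda>k \<and>
           neg_semidef
             (block_matrix
                (transpose (cl_A P K) ** X + X ** cl_A P K) (X ** cl_Bw P K)
                (transpose (cl_Bw P K) ** X)                0
              + transpose (block_matrix (cl_Cv P K) (cl_Dvw \<sigma> K) 0 (mat 1))
                ** multiplier \<alpha> \<Lambda>p \<Lambda>k
                ** block_matrix (cl_Cv P K) (cl_Dvw \<sigma> K) 0 (mat 1))"
  shows "satisfies_disk_margin P K \<alpha> \<sigma>"
proof -
  obtain X :: "real^('np + 'nk)^('np + 'nk)" and \<Lambda>p :: "real^'nu^'nu" and \<Lambda>k :: "real^'nphi^'nphi"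
    where X: "pos_def X" and Lp: "diagonal_matrix \<Lambda>p" "pos_semidef \<Lambda>p"
      and Lk: "diagonal_matrix \<Lambda>k" "pos_semidef \<Lambda>k"
      and lmi: "neg_semidef
             (block_matrix
                (transpose (cl_A P K) ** X + X ** cl_A P K) (X ** cl_Bw P K)
                (transpose (cl_Bw P K) ** X)                0
              + transpose (block_matrix (cl_Cv P K) (cl_Dvw \<sigma> K) 0 (mat 1))
                ** multiplier \<alpha> \<Lambda>p \<Lambda>k
                ** block_matrix (cl_Cv P K) (cl_Dvw \<sigma> K) 0 (mat 1))"
    using assms(3) by (elim exE conjE) (rule that)

  \<comment> \<open>Decrease of the storage function along a trajectory\<close>
  have decrease: "block_vec (xp T) (xk T) \<bullet> (X *v block_vec (xp T) (xk T))
      \<le> block_vec (xp 0) (xk 0) \<bullet> (X *v block_vec (xp 0) (xk 0))"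
    if \<Delta>: "\<Delta> \<in> uncertainties \<alpha>"
      and traj: "(xp, xk) \<in> closed_loop (uncertain_plant P \<sigma> \<Delta>) K" and "0 < T"
    for \<Delta> xp xk T
  proof -
    define x where "x t = block_vec (xp t) (xk t)" for t
    obtain u' y where ac: "abs_continuous_halfline xp" "abs_continuous_halfline xk"
      and plant: "\<exists>u. \<exists>vp\<in>L2e. \<exists>wp\<in>L2e. AE t in lebesgue. 0 \<le> t \<longrightarrow>
           (xp has_vector_derivative (Ap P *v xp t + Bp P *v u t)) (at t within {0..}) \<and>
           y t = Cp P *v xp t \<and>
           u t = vp t + ((1 - \<sigma>) / 2) *\<^sub>R wp t \<and>
           vp t = u' t + ((1 + \<sigma>) / 2) *\<^sub>R wp t \<and>
           wp t = \<Delta> vp t"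
      and controller: "\<exists>vk\<in>L2e. \<exists>wk\<in>L2e. AE t in lebesgue. 0 \<le> t \<longrightarrow>
           (xk has_vector_derivative
              (Ak K *v xk t + Bkw K *v wk t + Bky K *v y t)) (at t within {0..}) \<and>
           vk t = Ckv K *v xk t + Dkvw K *v wk t + Dkvy K *v y t \<and>
           u' t = Cku K *v xk t + Dkuw K *v wk t + Dkuy K *v y t \<and>
           wk t = act K (vk t)"
      using traj unfolding closed_loop_def uncertain_plant_def mem_Collect_eq split_conv by blast
    obtain u vp wp where vp: "vp \<in> L2e" and plant_ae: "AE t in lebesgue. 0 \<le> t \<longrightarrow>
           (xp has_vector_derivative (Ap P *v xp t + Bp P *v u t)) (at t within {0..}) \<and>
           y t = Cp P *v xp t \<and>
           u t = vp t + ((1 - \<sigma>) / 2) *\<^sub>R wp t \<and>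
           vp t = u' t + ((1 + \<sigma>) / 2) *\<^sub>R wp t \<and>
           wp t = \<Delta> vp t"
      using plant by blast
    obtain vk wk where controller_ae: "AE t in lebesgue. 0 \<le> t \<longrightarrow>
           (xk has_vector_derivative
              (Ak K *v xk t + Bkw K *v wk t + Bky K *v y t)) (at t within {0..}) \<and>
           vk t = Ckv K *v xk t + Dkvw K *v wk t + Dkvy K *v y t \<and>
           u' t = Cku K *v xk t + Dkuw K *v wk t + Dkuy K *v y t \<and>
           wk t = act K (vk t)"
      using controller by blast
    define x' where "x' t = cl_A P K *v x t + cl_Bw P K *v block_vec (wp t) (wk t)" for t
    \<comment> \<open>The bound is written with \<open>\<Delta> vp\<close>, almost everywhere equal
      to \<open>wp\<close>, because the gain estimate speaks of that signal.\<close>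
    define g where "g t = (\<Sum>i\<in>UNIV. \<Lambda>p $ i $ i * ((\<Delta> vp t $ i)\<^sup>2 - \<alpha>\<^sup>2 * (vp t $ i)\<^sup>2))" for t
    have "AE t in lebesgue. 0 \<le> t \<longrightarrow>
        (x has_vector_derivative x' t) (at t within {0..}) \<and> 2 * (x t \<bullet> (X *v x' t)) \<le> g t"
      using plant_ae controller_ae
    proof eventually_elim
      case (elim t)
      show ?case
      proof
        assume "0 \<le> t"
        with elim have
          p: "(xp has_vector_derivative (Ap P *v xp t + Bp P *v u t)) (at t within {0..})"
            "y t = Cp P *v xp t" "u t = vp t + ((1 - \<sigma>) / 2) *\<^sub>R wp t"
            "vp t = u' t + ((1 + \<sigma>) / 2) *\<^sub>R wp t" "wp t = \<Delta> vp t" and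
          k: "(xk has_vector_derivative
              (Ak K *v xk t + Bkw K *v wk t + Bky K *v y t)) (at t within {0..})"
            "vk t = Ckv K *v xk t + Dkvw K *v wk t + Dkvy K *v y t"
            "u' t = Cku K *v xk t + Dkuw K *v wk t + Dkuy K *v y t" "wk t = act K (vk t)"
          by blast+
        note dyn = closed_loop_dynamics[OF p(2-4) k(2,3), folded x_def]
        have "(x has_vector_derivative x' t) (at t within {0..})"
          using has_vector_derivative_block_vec[OF p(1) k(1)] unfolding dyn(1) x'_def
          by (simp add: x_def[abs_def])
        moreover have "2 * (x t \<bullet> (X *v x' t)) \<le> g t"
        proof -
          have "0 \<le> (\<Sum>i\<in>UNIV. \<Lambda>k $ i $ i * (wk t $ i * (vk t $ i - wk t $ i)))"
            unfolding k(4)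
            by (intro sum_nonneg mult_nonneg_nonneg pos_semidef_diag_nonneg Lk activation_sector assms)
          moreover have "g t = - (\<Sum>i\<in>UNIV. \<Lambda>p $ i $ i * (\<alpha>\<^sup>2 * (vp t $ i)\<^sup>2 - (wp t $ i)\<^sup>2))"
            unfolding g_def p(5) sum_negf[symmetric] by (intro sum.cong) (auto simp: algebra_simps)
          ultimately show ?thesis
            using matrix_inequality_dissipation[OF X Lp(1) Lk(1) lmi dyn(2)] unfolding x'_def by linarith
        qed
        ultimately show "(x has_vector_derivative x' t) (at t within {0..}) \<and> 2 * (x t \<bullet> (X *v x' t)) \<le> g t"
          by blast
      qed
    qed
    then obtain N where N: "negligible N" and good: "\<And>t. \<lbrakk>t \<notin> N; 0 \<le> t\<rbrakk> \<Longrightarrow>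
        (x has_vector_derivative x' t) (at t within {0..}) \<and> 2 * (x t \<bullet> (X *v x' t)) \<le> g t"
      unfolding eventually_ae_filter_negligible by blast
    let ?V = "\<lambda>t. x t \<bullet> (X *v x t)"
    \<comment> \<open>On the exceptional set the integrand is set to \<open>g t\<close>, so that it
      is at most \<open>g\<close> at every point of the interval, as the comparison of integrals
      requires.\<close>
    let ?V' = "\<lambda>t. if t \<in> N then g t else 2 * (x t \<bullet> (X *v x' t))"
    have "(?V' has_integral ?V T - ?V 0) {0..T}"
    proof (rule abs_continuous_has_integral[OF _ _ N])
      show "abs_continuous_on {0..T} ?V"
        using abs_continuous_halfline_block_vec[OF ac \<open>0 < T\<close>]
        by (intro abs_continuous_on_quadratic_form X) (simp add: x_def[abs_def])
      fix t
      assume t: "t \<in> {0..T} - N"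
      then have "(x has_vector_derivative x' t) (at t within {0..T})"
        using good[of t] by (auto intro: has_vector_derivative_within_subset)
      from has_vector_derivative_quadratic_form[OF X this]
      show "(?V has_vector_derivative ?V' t) (at t within {0..T})"
        using t by simp
    qed (use \<open>0 < T\<close> in simp)
    moreover have \<Delta>vp: "\<Delta> vp \<in> L2e"
      using \<Delta> vp by (simp add: uncertainties_def)
    \<comment> \<open>Square integrability of each channel turns its Lebesgue integral into a gauge
      integral, comparable with that of \<open>?V'\<close>.\<close>
    have "(g has_integral (\<Sum>i\<in>UNIV. \<Lambda>p $ i $ i *
        ((LINT t:{0..T}|lebesgue. (\<Delta> vp t $ i)\<^sup>2) - \<alpha>\<^sup>2 * (LINT t:{0..T}|lebesgue. (vp t $ i)\<^sup>2)))) {0..T}"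
      unfolding g_def
      by (intro has_integral_sum has_integral_mult_right has_integral_diff has_integral_set_lebesgue
          L2e_component_set_integrable \<Delta>vp vp \<open>0 < T\<close>) simp
    ultimately have "?V T - ?V 0 \<le> (\<Sum>i\<in>UNIV. \<Lambda>p $ i $ i *
        ((LINT t:{0..T}|lebesgue. (\<Delta> vp t $ i)\<^sup>2) - \<alpha>\<^sup>2 * (LINT t:{0..T}|lebesgue. (vp t $ i)\<^sup>2)))"
      by (rule has_integral_le) (use good in auto)
    also have "\<dots> \<le> 0"
      using uncertainty_channel_gain[OF \<Delta> vp \<open>0 < T\<close>] pos_semidef_diag_nonneg[OF Lp(2)]
      by (intro sum_nonpos mult_nonneg_nonpos) auto
    finally show ?thesis
      by (simp add: x_def)
  qed

  \<comment> \<open>From decrease to Lyapunov stability\<close>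
  obtain c C where cC: "0 < c" "0 < C" "\<And>x. c * (norm x)\<^sup>2 \<le> x \<bullet> (X *v x)"
      "\<And>x. x \<bullet> (X *v x) \<le> C * (norm x)\<^sup>2"
    by (rule pos_def_bounds[OF X]) blast
  have "lyapunov_stable (closed_loop (uncertain_plant P \<sigma> \<Delta>) K)" if \<Delta>: "\<Delta> \<in> uncertainties \<alpha>" for \<Delta>
    unfolding lyapunov_stable_def
  proof (intro allI impI)
    fix e :: real
    assume "0 < e"
    \<comment> \<open>Chosen so that \<open>C * d\<^sup>2 = c * e\<^sup>2\<close>, which closes the
      chain from the upper bound at time 0 to the lower bound at time \<open>t\<close>.\<close>
    define d where "d = sqrt (c / C) * e"
    have "0 < d" using cC \<open>0 < e\<close> by (simp add: d_def)
    have Cd: "C * d\<^sup>2 = c * e\<^sup>2"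
      using cC by (simp add: d_def power_mult_distrib)
    have "norm (xp t, xk t) < e"
      if traj: "(xp, xk) \<in> closed_loop (uncertain_plant P \<sigma> \<Delta>) K"
        and init: "norm (xp 0, xk 0) < d" and "0 \<le> t" for xp xk t
    proof -
      let ?x = "\<lambda>t. block_vec (xp t) (xk t)"
      have "c * (norm (?x t))\<^sup>2 \<le> ?x t \<bullet> (X *v ?x t)"
        by (rule cC)
      also have "\<dots> \<le> ?x 0 \<bullet> (X *v ?x 0)"
        \<comment> \<open>The decrease is available for positive times only; at time 0 both sides
          agree.\<close>
        using decrease[OF \<Delta> traj] \<open>0 \<le> t\<close> by (cases "t = 0") auto
      also have "\<dots> \<le> C * (norm (?x 0))\<^sup>2"
        by (rule cC)
      also have "\<dots> < C * d\<^sup>2"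
        using cC init by (simp add: norm_block_vec power_strict_mono)
      finally have "(norm (?x t))\<^sup>2 < e\<^sup>2"
        using cC by (simp add: Cd)
      then show ?thesis
        using \<open>0 < e\<close> by (simp add: norm_block_vec power2_less_imp_less)
    qed
    then show "\<exists>\<delta>>0. \<forall>(xp, xk)\<in>closed_loop (uncertain_plant P \<sigma> \<Delta>) K.
        norm (xp 0, xk 0) < \<delta> \<longrightarrow> (\<forall>t\<ge>0. norm (xp t, xk t) < e)"
      using \<open>0 < d\<close> by blast
  qed
  then show ?thesis
    unfolding satisfies_disk_margin_def uncertain_plants_def by blast
qed

end
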